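(* Let $X$ be a complex Banach space. The following assertions are equivalent: (1) $X^{*}$ is Fréchet differentiable. (2) For all sequences $(x_n)_{n\ge 0}$, $(y_n)_{n\ge 0}$ in $S_X$ and every $a^{*}\in S_{X^{*}}$ such that $\langle x_n,a^{*}\rangle\to 1$ and $\langle y_n,a^{*}\rangle\to 1$ as $n\to+\infty$, one has $\|x_n-y_n\|\to 0$ as $n\to+\infty$. (3) $X^{*}$ is uniformly smooth (in the sense defined in the context).
   Context: For a Banach space $Y$, $B_Y$ is its closed unit ball, $S_Y$ its unit sphere, $Y^{*}$ its dual, and $\langle y,y^{*}\rangle$ denotes the duality pairing of $y\in Y$ and $y^{*}\in Y^{*}$. Definition (Fréchet differentiable): a Banach space $Y$ is Fréchet differentiable if for every $y\in Y\setminus\{0\}$, $\displaystyle\lim_{\|h\|\to 0}\frac{\|y+h\|+\|y-h\|-2\|y\|}{\|h\|}=0$. Definition (uniformly smooth; this is the paper's own, pointwise, notion): a Banach space $Y$ is uniformly smooth if for every $y\in S_Y$ there exists a unique point $y^{*}\in S_{Y^{*}}$ such that for every $\varepsilon>0$ there exists $\delta>0$ (depending on $y$ and $\varepsilon$) with the property that $\|y^{*}-g\|<\varepsilon$ whenever $g\in B_{Y^{*}}$ and $\langle y,g\rangle>1-\delta$. In the complex case, the inequality $\langle y,g\rangle>1-\delta$ means that $\langle y,g\rangle$ is a real number and is greater than $1-\delta$. Both definitions are applied here with $Y=X^{*}$. *)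

theory Defs
  imports "HOL-Analysis.Analysis"
begin

text \<open>
  The distribution has no class of complex normed spaces. As in the real case the class below
  carries the norm of the space; the real scalar multiplication is required to be the restriction
  of the complex one, so that the library's metric and topological notions apply unchanged.
\<close>

class complex_normed_vector = real_normed_vector +
  fixes scaleC :: "complex \<Rightarrow> 'a \<Rightarrow> 'a"  (infixr \<open>*\<^sub>C\<close> 75)
  assumes scaleC_add_right: "c *\<^sub>C (x + y) = c *\<^sub>C x + c *\<^sub>C y"
    and scaleC_add_left: "(c + d) *\<^sub>C x = c *\<^sub>C x + d *\<^sub>C x"
    and scaleC_scaleC: "c *\<^sub>C d *\<^sub>C x = (c * d) *\<^sub>C x"
    and scaleC_one: "1 *\<^sub>C x = x"
    and scaleR_scaleC: "r *\<^sub>R x = complex_of_real r *\<^sub>C x"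
    and norm_scaleC: "norm (c *\<^sub>C x) = cmod c * norm x"

class complex_banach = complex_normed_vector + complete_space

subclass (in complex_banach) banach ..

instantiation complex :: complex_banach
begin

definition scaleC_complex :: "complex \<Rightarrow> complex \<Rightarrow> complex"
  where "scaleC_complex c x = c * x"

instance
  by standard (auto simp: scaleC_complex_def algebra_simps norm_mult scaleR_conv_of_real)

end

text \<open>
  The dual space: complex-linear bounded functionals. The operator norm is inherited from the
  library type of bounded real-linear maps into \<open>complex\<close>.
\<close>

typedef (overloaded) ('a::complex_normed_vector) cdual =
  "{f :: 'a \<Rightarrow>\<^sub>L complex. \<forall>c x. blinfun_apply f (c *\<^sub>C x) = c * blinfun_apply f x}"
  morphisms blinfun_of_cdual Abs_cdual
  by (rule exI[of _ 0]) simp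

definition cdual_apply :: "'a::complex_normed_vector cdual \<Rightarrow> 'a \<Rightarrow> complex"
  where "cdual_apply f x = blinfun_apply (blinfun_of_cdual f) x"

lemma cdual_apply_scaleC: "cdual_apply f (c *\<^sub>C x) = c * cdual_apply f x"
  using blinfun_of_cdual[of f] by (simp add: cdual_apply_def)

lemma blinfun_of_cdual_eqI: "blinfun_of_cdual f = blinfun_of_cdual g \<Longrightarrow> f = g"
  by (simp add: blinfun_of_cdual_inject)

lemma bounded_linear_mult_blinfun:
  "bounded_linear (\<lambda>x. c * blinfun_apply f x)" for f :: "'a::real_normed_vector \<Rightarrow>\<^sub>L complex"
  by (intro bounded_linear_intros)

definition blinfun_cmult :: "complex \<Rightarrow> ('a::real_normed_vector \<Rightarrow>\<^sub>L complex) \<Rightarrow> 'a \<Rightarrow>\<^sub>L complex"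
  where "blinfun_cmult c f = Blinfun (\<lambda>x. c * blinfun_apply f x)"

lemma blinfun_apply_cmult [simp]: "blinfun_apply (blinfun_cmult c f) x = c * blinfun_apply f x"
  by (simp add: blinfun_cmult_def bounded_linear_Blinfun_apply bounded_linear_mult_blinfun)

lemma norm_blinfun_cmult_le: "norm (blinfun_cmult c f) \<le> cmod c * norm f"
proof (rule norm_blinfun_bound)
  fix x
  show "norm (blinfun_apply (blinfun_cmult c f) x) \<le> cmod c * norm f * norm x"
    using mult_left_mono[OF norm_blinfun[of f x], of "cmod c"] by (simp add: norm_mult mult.assoc)
qed simp

lemma norm_blinfun_cmult: "norm (blinfun_cmult c f) = cmod c * norm f"
proof (cases "c = 0")
  case True
  then show ?thesis using norm_blinfun_cmult_le[of c f] by simp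
next
  case False
  have "blinfun_cmult (inverse c) (blinfun_cmult c f) = f"
    using False by (intro blinfun_eqI) simp
  then have "norm f \<le> cmod (inverse c) * norm (blinfun_cmult c f)"
    by (metis norm_blinfun_cmult_le)
  then have "cmod c * norm f \<le> norm (blinfun_cmult c f)"
    using False by (simp add: norm_inverse norm_divide field_simps)
  then show ?thesis using norm_blinfun_cmult_le[of c f] by simp
qed

instantiation cdual :: (complex_normed_vector) complex_normed_vector
begin

definition zero_cdual :: "'a cdual" where "0 = Abs_cdual 0"

definition plus_cdual :: "'a cdual \<Rightarrow> 'a cdual \<Rightarrow> 'a cdual"
  where "f + g = Abs_cdual (blinfun_of_cdual f + blinfun_of_cdual g)"

definition minus_cdual :: "'a cdual \<Rightarrow> 'a cdual \<Rightarrow> 'a cdual"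
  where "f - g = Abs_cdual (blinfun_of_cdual f - blinfun_of_cdual g)"

definition uminus_cdual :: "'a cdual \<Rightarrow> 'a cdual"
  where "- f = Abs_cdual (- blinfun_of_cdual f)"

definition scaleR_cdual :: "real \<Rightarrow> 'a cdual \<Rightarrow> 'a cdual"
  where "r *\<^sub>R f = Abs_cdual (r *\<^sub>R blinfun_of_cdual f)"

definition scaleC_cdual :: "complex \<Rightarrow> 'a cdual \<Rightarrow> 'a cdual"
  where "c *\<^sub>C f = Abs_cdual (blinfun_cmult c (blinfun_of_cdual f))"

definition norm_cdual :: "'a cdual \<Rightarrow> real"
  where "norm_cdual f = norm (blinfun_of_cdual f)"

definition dist_cdual :: "'a cdual \<Rightarrow> 'a cdual \<Rightarrow> real"
  where "dist_cdual f g = norm (f - g)"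

definition sgn_cdual :: "'a cdual \<Rightarrow> 'a cdual"
  where "sgn_cdual f = inverse (norm f) *\<^sub>R f"

definition uniformity_cdual :: "('a cdual \<times> 'a cdual) filter"
  where "uniformity_cdual = (INF e\<in>{0<..}. principal {(f, g). dist f g < e})"

definition open_cdual :: "'a cdual set \<Rightarrow> bool"
  where "open_cdual S = (\<forall>f\<in>S. \<forall>\<^sub>F (f', g) in uniformity. f' = f \<longrightarrow> g \<in> S)"

lemma blinfun_of_cdual_simps:
  "blinfun_of_cdual (0 :: 'a cdual) = 0"
  "blinfun_of_cdual (f + g) = blinfun_of_cdual f + blinfun_of_cdual g"
  "blinfun_of_cdual (f - g) = blinfun_of_cdual f - blinfun_of_cdual g"
  "blinfun_of_cdual (- f) = - blinfun_of_cdual f"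
  "blinfun_of_cdual (r *\<^sub>R f) = r *\<^sub>R blinfun_of_cdual f"
  "blinfun_of_cdual (c *\<^sub>C f) = blinfun_cmult c (blinfun_of_cdual f)"
  for f g :: "'a cdual"
  using blinfun_of_cdual[of f] blinfun_of_cdual[of g]
  by (auto simp: zero_cdual_def plus_cdual_def minus_cdual_def uminus_cdual_def
      scaleR_cdual_def scaleC_cdual_def Abs_cdual_inverse blinfun.bilinear_simps algebra_simps)

instance
proof
  fix f g h :: "'a cdual" and r s :: real and c d :: complex
  note simps = blinfun_of_cdual_simps norm_cdual_def
  show "f + g + h = f + (g + h)"
    by (rule blinfun_of_cdual_eqI) (simp add: simps)
  show "f + g = g + f"
    by (rule blinfun_of_cdual_eqI) (simp add: simps)
  show "0 + f = f"
    by (rule blinfun_of_cdual_eqI) (simp add: simps)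
  show "- f + f = 0"
    by (rule blinfun_of_cdual_eqI) (simp add: simps)
  show "f - g = f + - g"
    by (rule blinfun_of_cdual_eqI) (simp add: simps)
  show "r *\<^sub>R (f + g) = r *\<^sub>R f + r *\<^sub>R g"
    by (rule blinfun_of_cdual_eqI) (simp add: simps scaleR_add_right)
  show "(r + s) *\<^sub>R f = r *\<^sub>R f + s *\<^sub>R f"
    by (rule blinfun_of_cdual_eqI) (simp add: simps scaleR_add_left)
  show "r *\<^sub>R s *\<^sub>R f = (r * s) *\<^sub>R f"
    by (rule blinfun_of_cdual_eqI) (simp add: simps)
  show "1 *\<^sub>R f = f"
    by (rule blinfun_of_cdual_eqI) (simp add: simps)
  show "dist f g = norm (f - g)"
    by (rule dist_cdual_def)
  show "sgn f = inverse (norm f) *\<^sub>R f"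
    by (rule sgn_cdual_def)
  show "(uniformity :: ('a cdual \<times> 'a cdual) filter) =
      (INF e\<in>{0<..}. principal {(x, y). dist x y < e})"
    by (rule uniformity_cdual_def)
  show "open U = (\<forall>x\<in>U. \<forall>\<^sub>F (x', y) in uniformity. x' = x \<longrightarrow> y \<in> U)" for U :: "'a cdual set"
    by (rule open_cdual_def)
  show "norm f = 0 \<longleftrightarrow> f = 0"
    using blinfun_of_cdual_eqI[of f 0] by (auto simp: simps)
  show "norm (f + g) \<le> norm f + norm g"
    by (simp add: simps norm_triangle_ineq)
  show "norm (r *\<^sub>R f) = \<bar>r\<bar> * norm f"
    by (simp add: simps)
  show "c *\<^sub>C (f + g) = c *\<^sub>C f + c *\<^sub>C g"
    by (intro blinfun_of_cdual_eqI blinfun_eqI)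
      (simp add: simps blinfun.bilinear_simps algebra_simps)
  show "(c + d) *\<^sub>C f = c *\<^sub>C f + d *\<^sub>C f"
    by (intro blinfun_of_cdual_eqI blinfun_eqI)
      (simp add: simps blinfun.bilinear_simps algebra_simps)
  show "c *\<^sub>C d *\<^sub>C f = (c * d) *\<^sub>C f"
    by (intro blinfun_of_cdual_eqI blinfun_eqI) (simp add: simps)
  show "1 *\<^sub>C f = f"
    by (intro blinfun_of_cdual_eqI blinfun_eqI) (simp add: simps)
  show "r *\<^sub>R f = complex_of_real r *\<^sub>C f"
    by (intro blinfun_of_cdual_eqI blinfun_eqI)
      (simp add: simps blinfun.bilinear_simps scaleR_conv_of_real)
  show "norm (c *\<^sub>C f) = cmod c * norm f"
    by (simp add: simps norm_blinfun_cmult)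
qed

end

lemma norm_cdual_onorm: "norm f = onorm (cdual_apply f)"
  by (simp add: norm_cdual_def norm_blinfun.rep_eq cdual_apply_def [abs_def])

instance cdual :: (complex_normed_vector) complex_banach
proof
  fix X :: "nat \<Rightarrow> 'a cdual"
  assume X: "Cauchy X"
  have dist_eq: "dist f g = dist (blinfun_of_cdual f) (blinfun_of_cdual g)" for f g :: "'a cdual"
    by (simp add: dist_norm norm_cdual_def blinfun_of_cdual_simps)
  have "Cauchy (\<lambda>n. blinfun_of_cdual (X n))"
    using X by (simp add: Cauchy_def dist_eq)
  then obtain L where L: "(\<lambda>n. blinfun_of_cdual (X n)) \<longlonglongrightarrow> L"
    by (metis Cauchy_convergent_iff convergent_def)
  have lim: "(\<lambda>n. blinfun_apply (blinfun_of_cdual (X n)) x) \<longlonglongrightarrow> blinfun_apply L x" for x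
    by (intro tendsto_intros L)
  have "blinfun_apply L (c *\<^sub>C x) = c * blinfun_apply L x" for c x
  proof (rule LIMSEQ_unique[OF lim])
    have "(\<lambda>n. c * blinfun_apply (blinfun_of_cdual (X n)) x) \<longlonglongrightarrow> c * blinfun_apply L x"
      by (intro tendsto_intros lim)
    then show "(\<lambda>n. blinfun_apply (blinfun_of_cdual (X n)) (c *\<^sub>C x)) \<longlonglongrightarrow> c * blinfun_apply L x"
      by (simp add: cdual_apply_scaleC [unfolded cdual_apply_def])
  qed
  then have "blinfun_of_cdual (Abs_cdual L) = L"
    by (simp add: Abs_cdual_inverse)
  then have "X \<longlonglongrightarrow> Abs_cdual L"
    using L by (simp add: tendsto_iff dist_eq)
  then show "convergent X"
    by (auto simp: convergent_def)
qed

definition frechet_differentiable :: "'y::banach itself \<Rightarrow> bool"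
  where "frechet_differentiable _ \<longleftrightarrow>
    (\<forall>y::'y. y \<noteq> 0 \<longrightarrow>
      ((\<lambda>h. (norm (y + h) + norm (y - h) - 2 * norm y) / norm h) \<longlongrightarrow> 0) (at 0))"

text \<open>
  A pointwise notion, not the classical uniform one: \<open>\<delta>\<close> may depend on \<open>y\<close>. The condition
  \<open>\<langle>y, g\<rangle> > 1 - \<delta>\<close> includes that the pairing is a real number.
\<close>

definition uniformly_smooth :: "'y::complex_banach itself \<Rightarrow> bool"
  where "uniformly_smooth _ \<longleftrightarrow>
    (\<forall>y\<in>sphere (0::'y) 1. \<exists>!y'. y' \<in> sphere (0::'y cdual) 1 \<and>
      (\<forall>\<epsilon>>0. \<exists>\<delta>>0. \<forall>g\<in>cball (0::'y cdual) 1.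
        cdual_apply g y \<in> \<real> \<and> Re (cdual_apply g y) > 1 - \<delta> \<longrightarrow> norm (y' - g) < \<epsilon>))"

end

theory Submission
  imports Defs
begin

text \<open>
  Frechet differentiability at a unit vector \<open>y\<close> says that
  \<open>\<parallel>y + h\<parallel> + \<parallel>y - h\<parallel> \<le> 2 + \<epsilon> \<parallel>h\<parallel>\<close> for small \<open>h\<close>. Following Smulian, evaluate
  \<open>y + h\<close> and \<open>y - h\<close> at two points \<open>u, v\<close> of the unit ball of the dual (or the predual):
  if both almost norm \<open>y\<close>, then \<open>\<langle>u - v, h\<rangle>\<close> is controlled by \<open>\<epsilon> \<parallel>h\<parallel>\<close>, hence \<open>u\<close> and \<open>v\<close>
  are close; conversely, choosing \<open>u\<close> and \<open>v\<close> to norm \<open>y + h\<close> and \<open>y - h\<close>, closeness of \<open>u\<close>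
  and \<open>v\<close> gives the estimate. Since \<open>X\<close> itself (almost) norms \<open>X\<^sup>*\<close>, assertion (2) is compared
  with (1) without passing to the bidual.
\<close>

section \<open>The Hahn-Banach theorem\<close>

text \<open>Only one half of positive homogeneity is demanded, the half that asks for a lower bound
  on \<open>p (t *\<^sub>R x)\<close> and so passes directly to infima. Applying it to
  \<open>inverse t\<close> gives the other half.\<close>

definition sublinear :: "('a::real_vector \<Rightarrow> real) \<Rightarrow> bool"
  where "sublinear p \<longleftrightarrow>
    (\<forall>x y. p (x + y) \<le> p x + p y) \<and> (\<forall>t>0. \<forall>x. t * p x \<le> p (t *\<^sub>R x))"

lemma sublinearI:
  assumes "\<And>x y. p (x + y) \<le> p x + p y" "\<And>t x. t > 0 \<Longrightarrow> t * p x \<le> p (t *\<^sub>R x)"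
  shows "sublinear p"
  using assms by (simp add: sublinear_def)

lemma sublinear_add: "sublinear p \<Longrightarrow> p (x + y) \<le> p x + p y"
  by (simp add: sublinear_def)

lemma sublinear_scale:
  assumes p: "sublinear p" and t: "t > 0"
  shows "p (t *\<^sub>R x) = t * p x"
proof (rule antisym)
  have "inverse t * p (t *\<^sub>R x) \<le> p (inverse t *\<^sub>R t *\<^sub>R x)"
    using p t unfolding sublinear_def by (metis positive_imp_inverse_positive)
  then show "p (t *\<^sub>R x) \<le> t * p x"
    using t by (simp add: field_simps)
  show "t * p x \<le> p (t *\<^sub>R x)"
    using p t by (simp add: sublinear_def)
qed

lemma sublinear_zero: "sublinear p \<Longrightarrow> p 0 = 0"
  using sublinear_scale[of p 2 0] by simp

lemma sublinear_scale_nonneg: "sublinear p \<Longrightarrow> t \<ge> 0 \<Longrightarrow> p (t *\<^sub>R x) = t * p x"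
  by (cases "t = 0") (auto simp: sublinear_scale sublinear_zero)

lemma sublinear_ge_minus: "sublinear p \<Longrightarrow> - p (- x) \<le> p x"
  using sublinear_add[of p x "- x"] by (simp add: sublinear_zero)

lemma sublinear_norm: "sublinear norm"
  by (rule sublinearI) (auto simp: norm_triangle_ineq)

text \<open>The largest sublinear functional \<open>r \<le> p\<close> with \<open>r (- z) = - p z\<close>.\<close>

definition linearize_along :: "('a::real_vector \<Rightarrow> real) \<Rightarrow> 'a \<Rightarrow> 'a \<Rightarrow> real"
  where "linearize_along p z x = (INF t\<in>{0..}. p (x + t *\<^sub>R z) - t * p z)"

lemma linearize_along_le:
  assumes p: "sublinear p" and "t \<ge> 0"
  shows "linearize_along p z x \<le> p (x + t *\<^sub>R z) - t * p z"
  unfolding linearize_along_def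
proof (rule cINF_lower)
  show "bdd_below ((\<lambda>t. p (x + t *\<^sub>R z) - t * p z) ` {0..})"
  proof (rule bdd_belowI2)
    fix t :: real
    assume "t \<in> {0..}"
    \<comment> \<open>Splitting \<open>t *\<^sub>R z\<close> as
      \<open>(x + t *\<^sub>R z) + (- x)\<close> gives a lower bound free of \<open>t\<close>, so
      the infimum is a genuine one.\<close>
    then show "- p (- x) \<le> p (x + t *\<^sub>R z) - t * p z"
      using sublinear_add[OF p, of "x + t *\<^sub>R z" "- x"] by (simp add: sublinear_scale_nonneg p)
  qed
qed (use assms in simp)

lemma linearize_along_greatest:
  assumes "\<And>t. t \<ge> 0 \<Longrightarrow> c \<le> p (x + t *\<^sub>R z) - t * p z"
  shows "c \<le> linearize_along p z x"
  unfolding linearize_along_def using assms by (intro cINF_greatest) auto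

lemma linearize_along_le_self: "sublinear p \<Longrightarrow> linearize_along p z \<le> p"
  using linearize_along_le[of p 0 z] by (auto simp: le_fun_def)

text \<open>Parameters \<open>s\<close> for \<open>x\<close> and \<open>t\<close> for
  \<open>y\<close> combine to the parameter \<open>s + t\<close> for \<open>x + y\<close>; the two
  infima are then taken one after the other. Homogeneity is the substitution of \<open>t / s\<close>
  for \<open>t\<close>.\<close>

lemma sublinear_linearize_along:
  assumes p: "sublinear p"
  shows "sublinear (linearize_along p z)"
proof (rule sublinearI)
  let ?q = "linearize_along p z"
  fix x y :: 'a
  have "?q (x + y) - (p (x + s *\<^sub>R z) - s * p z) \<le> p (y + t *\<^sub>R z) - t * p z"
    if "s \<ge> 0" "t \<ge> 0" for s t
    using linearize_along_le[OF p, of "s + t" z "x + y"]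
      sublinear_add[OF p, of "x + s *\<^sub>R z" "y + t *\<^sub>R z"] that
    by (simp add: algebra_simps)
  then have "?q (x + y) - (p (x + s *\<^sub>R z) - s * p z) \<le> ?q y" if "s \<ge> 0" for s
    using that by (intro linearize_along_greatest) auto
  then have "?q (x + y) - ?q y \<le> ?q x"
    by (intro linearize_along_greatest) (auto simp: algebra_simps)
  then show "?q (x + y) \<le> ?q x + ?q y"
    by simp
next
  fix s :: real and x :: 'a
  assume s: "s > 0"
  show "s * linearize_along p z x \<le> linearize_along p z (s *\<^sub>R x)"
  proof (rule linearize_along_greatest)
    fix t :: real
    assume "t \<ge> 0"
    then have "s * linearize_along p z x \<le> s * (p (x + (t / s) *\<^sub>R z) - (t / s) * p z)"
      using linearize_along_le[OF p, of "t / s" z x] s by (intro mult_left_mono) auto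
    also have "\<dots> = p (s *\<^sub>R (x + (t / s) *\<^sub>R z)) - t * p z"
      using s by (simp add: sublinear_scale[OF p] right_diff_distrib)
    also have "\<dots> = p (s *\<^sub>R x + t *\<^sub>R z) - t * p z"
      using s by (simp add: scaleR_add_right)
    finally show "s * linearize_along p z x \<le> p (s *\<^sub>R x + t *\<^sub>R z) - t * p z" .
  qed
qed

text \<open>Minimality forces \<open>linearize_along q y = q\<close> for every \<open>y\<close>. The
  term with parameter 1 in that infimum then gives the reverse of subadditivity.\<close>

lemma linear_if_minimal_sublinear:
  assumes q: "sublinear q" and min: "\<And>r. sublinear r \<Longrightarrow> r \<le> q \<Longrightarrow> r = q"
  shows "linear q"
proof -
  have add: "q (x + y) = q x + q y" for x y
  proof (rule antisym)
    have "linearize_along q y = q"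
      by (intro min sublinear_linearize_along linearize_along_le_self q)
    then show "q x + q y \<le> q (x + y)"
      using linearize_along_le[OF q, of 1 y x] by simp
  qed (rule sublinear_add[OF q])
  have neg: "q (- x) = - q x" for x
    using add[of x "- x"] by (simp add: sublinear_zero[OF q])
  have "q (t *\<^sub>R x) = t * q x" for t x
  proof (cases "t \<ge> 0")
    case False
    then show ?thesis
      using sublinear_scale[OF q, of "- t" x] by (simp add: neg)
  qed (simp add: sublinear_scale_nonneg[OF q])
  then show ?thesis
    by (intro linearI) (simp_all add: add)
qed

text \<open>Zorn's lemma for the reversed order: the pointwise infimum bounds a nonempty chain. It
  is finite because every \<open>r\<close> below \<open>p\<close> satisfies
  \<open>- p (- x) \<le> - r (- x) \<le> r x\<close>.\<close>

lemma ex_minimal_sublinear: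
  assumes p: "sublinear p"
  obtains q where "sublinear q" "q \<le> p" "\<And>r. sublinear r \<Longrightarrow> r \<le> q \<Longrightarrow> r = q"
proof -
  let ?A = "{q. sublinear q \<and> q \<le> p}"
  have "\<exists>m\<in>?A. \<forall>r\<in>?A. m \<ge> r \<longrightarrow> r = m"
  proof (rule predicate_Zorn)
    show "partial_order_on ?A (relation_of (\<ge>) ?A)"
      by (rule partial_order_on_relation_ofI) auto
    fix C
    assume "C \<in> Chains (relation_of (\<ge>) ?A)"
    then have C: "\<And>r. r \<in> C \<Longrightarrow> sublinear r \<and> r \<le> p"
      and chain: "\<And>r s. r \<in> C \<Longrightarrow> s \<in> C \<Longrightarrow> r \<le> s \<or> s \<le> r"
      unfolding Chains_def relation_of_def by auto
    show "\<exists>u\<in>?A. \<forall>r\<in>C. r \<ge> u"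
    proof (cases "C = {}")
      case True
      then show ?thesis
        using p by auto
    next
      case False
      define u where "u x = (INF r\<in>C. r x)" for x
      have bdd: "bdd_below ((\<lambda>r. r x) ` C)" for x
      proof (rule bdd_belowI2)
        fix r
        assume "r \<in> C"
        then show "- p (- x) \<le> r x"
          using C[of r] sublinear_ge_minus[of r x] le_funD[of r p "- x"] by linarith
      qed
      have le: "u x \<le> r x" if "r \<in> C" for r x
        unfolding u_def using bdd that by (rule cINF_lower)
      have greatest: "c \<le> u x" if "\<And>r. r \<in> C \<Longrightarrow> c \<le> r x" for c x
        unfolding u_def using False that by (rule cINF_greatest)
      \<comment> \<open>Subadditivity of an infimum uses the chain condition here: a single
        \<open>m\<close> lies below both \<open>r\<close> and \<open>s\<close>.\<close>
      have two: "u (x + y) \<le> r x + s y" if rs: "r \<in> C" "s \<in> C" for r s x y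
      proof -
        obtain m where m: "m \<in> C" "m \<le> r" "m \<le> s"
          using chain[OF rs] rs by auto
        have "u (x + y) \<le> m x + m y"
          using le[OF m(1)] C[OF m(1)] sublinear_add order_trans by blast
        then show ?thesis
          using le_funD[OF m(2), of x] le_funD[OF m(3), of y] by linarith
      qed
      have "sublinear u"
      proof (rule sublinearI)
        fix x y
        have "u (x + y) - r x \<le> u y" if "r \<in> C" for r
          using two[OF that] by (intro greatest) (simp add: algebra_simps)
        then have "u (x + y) - u y \<le> u x"
          by (intro greatest) (simp add: algebra_simps)
        then show "u (x + y) \<le> u x + u y"
          by simp
      next
        fix t :: real and x
        assume "t > 0"
        then show "t * u x \<le> u (t *\<^sub>R x)"
          using C le by (intro greatest) (auto simp: sublinear_scale)
      qed
      moreover have "u \<le> p"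
        using False le C by (meson all_not_in_conv le_funI le_funD order_trans)
      ultimately show ?thesis
        using le by (auto simp: le_fun_def)
    qed
  qed
  then show thesis
    using that by (metis (no_types, lifting) mem_Collect_eq order_trans)
qed

text \<open>Minimizing below \<open>linearize_along norm z\<close> instead of below
  \<open>norm\<close> builds the norming property in: that functional is at most
  \<open>- norm z\<close> at \<open>- z\<close>, hence so is \<open>f\<close>, and linearity turns
  this into \<open>f z \<ge> norm z\<close>.\<close>

lemma ex_norming_functional_real:
  fixes z :: "'a::real_normed_vector"
  obtains f :: "'a \<Rightarrow> real" where "linear f" "\<And>x. f x \<le> norm x" "f z = norm z"
proof -
  define p where "p = linearize_along norm z"
  obtain f where f: "sublinear f" "f \<le> p" "\<And>r. sublinear r \<Longrightarrow> r \<le> f \<Longrightarrow> r = f"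
    using ex_minimal_sublinear sublinear_linearize_along[OF sublinear_norm] unfolding p_def by blast
  have lin: "linear f"
    using f by (intro linear_if_minimal_sublinear) auto
  have le: "f x \<le> norm x" for x
    using le_funD[OF f(2), of x] le_funD[OF linearize_along_le_self[OF sublinear_norm], of z x]
    unfolding p_def by linarith
  have "f (- z) \<le> - norm z"
    using le_funD[OF f(2), of "- z"] linearize_along_le[OF sublinear_norm, of 1 z "- z"]
    unfolding p_def by simp
  then have "f z = norm z"
    using le[of z] by (simp add: linear_neg[OF lin])
  then show thesis
    using that lin le by blast
qed

section \<open>Complex-linear functionals\<close>

lemma cdual_apply_simps [simp]:
  "cdual_apply (f + g) x = cdual_apply f x + cdual_apply g x"
  "cdual_apply (f - g) x = cdual_apply f x - cdual_apply g x"
  "cdual_apply (c *\<^sub>C f) x = c * cdual_apply f x"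
  "cdual_apply f (x + y) = cdual_apply f x + cdual_apply f y"
  "cdual_apply f (x - y) = cdual_apply f x - cdual_apply f y"
  "cdual_apply f (r *\<^sub>R x) = r * cdual_apply f x"
  "cdual_apply f (c *\<^sub>C x) = c * cdual_apply f x"
  by (simp_all add: cdual_apply_def blinfun_of_cdual_simps blinfun.bilinear_simps
      scaleR_conv_of_real cdual_apply_scaleC[unfolded cdual_apply_def])

lemma norm_cdual_apply_le: "cmod (cdual_apply f x) \<le> norm f * norm x"
  unfolding cdual_apply_def norm_cdual_def by (rule norm_blinfun)

lemma Re_cdual_apply_le: "Re (cdual_apply f x) \<le> norm f * norm x"
  using complex_Re_le_cmod norm_cdual_apply_le by (rule order_trans)

lemma Re_cdual_apply_le_unit: "norm x \<le> 1 \<Longrightarrow> Re (cdual_apply f x) \<le> norm f"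
  using Re_cdual_apply_le[of f x] mult_left_mono[of "norm x" 1 "norm f"] by simp

lemma Re_cdual_apply_le_norm: "norm f \<le> 1 \<Longrightarrow> Re (cdual_apply f x) \<le> norm x"
  using Re_cdual_apply_le[of f x] mult_right_mono[of "norm f" 1 "norm x"] by simp

text \<open>Rotating by \<open>c\<close> turns moduli into real parts. The zero case is separate
  because \<open>cnj w / of_real (cmod w)\<close> is then 0 and not unimodular.\<close>

lemma ex_rotation:
  obtains c where "cmod c = 1" "c * w = of_real (cmod w)"
proof (cases "w = 0")
  case True
  then show thesis
    using that[of 1] by simp
next
  case False
  have "cnj w / of_real (cmod w) * w = of_real (cmod w)"
    using False complex_norm_square[of w] by (simp add: field_simps power2_eq_square)
  then show thesis
    using False by (intro that[of "cnj w / of_real (cmod w)"]) (auto simp: norm_divide)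
qed

text \<open>By complex linearity \<open>x\<close> can be rotated until \<open>f x\<close> equals its
  own modulus, so real parts on the sphere determine the norm. The condition
  \<open>b \<ge> 0\<close> covers the zero space, where the sphere is empty.\<close>

lemma norm_cdual_bound_Re:
  assumes "b \<ge> 0" "\<And>x. norm x = 1 \<Longrightarrow> Re (cdual_apply f x) \<le> b"
  shows "norm f \<le> b"
  unfolding norm_cdual_def
proof (rule norm_blinfun_bound)
  fix x
  show "norm (blinfun_apply (blinfun_of_cdual f) x) \<le> b * norm x"
    unfolding cdual_apply_def[symmetric]
  proof (cases "x = 0")
    case True
    then show "cmod (cdual_apply f x) \<le> b * norm x"
      using norm_cdual_apply_le[of f x] by simp
  next
    case False
    obtain c where c: "cmod c = 1" "c * cdual_apply f x = of_real (cmod (cdual_apply f x))"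
      by (rule ex_rotation)
    have "Re (cdual_apply f (inverse (norm x) *\<^sub>R c *\<^sub>C x)) \<le> b"
      using False c by (intro assms) (simp add: norm_scaleC)
    then show "cmod (cdual_apply f x) \<le> b * norm x"
      using False by (simp add: c(2) field_simps)
  qed
qed (rule assms)

lemma ex_almost_norming_vector:
  fixes f :: "'a::complex_normed_vector cdual"
  assumes ne: "\<exists>x::'a. x \<noteq> 0" and "\<eta> > 0"
  obtains x where "norm x = 1" "cdual_apply f x \<in> \<real>" "Re (cdual_apply f x) \<ge> norm f - \<eta>"
proof -
  obtain x where x: "norm x = 1" "Re (cdual_apply f x) \<ge> norm f - \<eta>"
  \<comment> \<open>\<open>norm_cdual_bound_Re\<close> accepts nonnegative bounds only. Against a
    negative bound any unit vector will do, once rotated to a nonnegative value of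
    \<open>f\<close>.\<close>
  proof (cases "norm f - \<eta> \<ge> 0")
    case True
    have "\<not> norm f \<le> norm f - \<eta>"
      using \<open>\<eta> > 0\<close> by simp
    then show thesis
      using norm_cdual_bound_Re[OF True, of f] that by (meson linear)
  next
    case False
    obtain x0 :: 'a where x0: "x0 \<noteq> 0"
      using ne by blast
    obtain c where c: "cmod c = 1" "c * cdual_apply f x0 = of_real (cmod (cdual_apply f x0))"
      by (rule ex_rotation)
    show thesis
      using x0 c False
      by (intro that[of "inverse (norm x0) *\<^sub>R c *\<^sub>C x0"])
        (auto simp: norm_scaleC intro: order_trans[of _ 0])
  qed
  \<comment> \<open>A second rotation makes the value real and does not decrease its real
    part.\<close>
  obtain c where c: "cmod c = 1" "c * cdual_apply f x = of_real (cmod (cdual_apply f x))"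
    by (rule ex_rotation)
  show thesis
    using x c complex_Re_le_cmod[of "cdual_apply f x"]
    by (intro that[of "c *\<^sub>C x"]) (auto simp: norm_scaleC)
qed

text \<open>The complex Hahn-Banach theorem by complexification: a real norming functional
  \<open>u\<close> is the real part of the complex-linear \<open>g\<close>. Rotating
  \<open>x\<close> shows that \<open>cmod (g x)\<close> is a value of \<open>u\<close> at a vector
  of the same norm.\<close>

lemma ex_norming_cdual:
  fixes z :: "'a::complex_normed_vector"
  obtains f :: "'a cdual" where "norm f \<le> 1" "cdual_apply f z = norm z"
proof -
  obtain u :: "'a \<Rightarrow> real" where u: "linear u" "\<And>x. u x \<le> norm x" "u z = norm z"
    using ex_norming_functional_real by blast
  define g where "g x = Complex (u x) (- u (\<i> *\<^sub>C x))" for x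
  have add: "g (x + y) = g x + g y" for x y
    by (simp add: g_def linear_add[OF u(1)] scaleC_add_right complex_eq_iff)
  have scale: "g (c *\<^sub>C x) = c * g x" for c x
  proof -
    have split: "u (d *\<^sub>C y) = Re d * u y + Im d * u (\<i> *\<^sub>C y)" for d y
    proof -
      have "of_real (Re d) + of_real (Im d) * \<i> = d"
        by (simp add: complex_eq_iff)
      then have "d *\<^sub>C y = Re d *\<^sub>R y + Im d *\<^sub>R \<i> *\<^sub>C y"
        by (simp add: scaleR_scaleC scaleC_scaleC flip: scaleC_add_left)
      then show ?thesis
        by (simp add: linear_add[OF u(1)] linear_scale[OF u(1)])
    qed
    show ?thesis
      using split[of c x] split[of "\<i> * c" x] by (simp add: g_def scaleC_scaleC complex_eq_iff)
  qed
  have bound: "cmod (g x) \<le> norm x" for x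
  proof -
    obtain c where c: "cmod c = 1" "c * g x = of_real (cmod (g x))"
      by (rule ex_rotation)
    have "cmod (g x) = u (c *\<^sub>C x)"
      using arg_cong[OF c(2), of Re] by (simp flip: scale) (simp add: g_def)
    also have "\<dots> \<le> norm x"
      using u(2)[of "c *\<^sub>C x"] c by (simp add: norm_scaleC)
    finally show ?thesis .
  qed
  have bl: "bounded_linear g"
    by (rule bounded_linear_intro[where K = 1])
      (use bound in \<open>auto simp: add scale scaleR_scaleC[where 'a = 'a] scaleR_conv_of_real\<close>)
  define f where "f = Abs_cdual (Blinfun g)"
  have "cdual_apply f x = g x" for x
    unfolding f_def cdual_apply_def
    by (subst Abs_cdual_inverse) (auto simp: bounded_linear_Blinfun_apply[OF bl] scale)
  note app = this
  have f1: "norm f \<le> 1"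
  proof (rule norm_cdual_bound_Re)
    fix x :: 'a assume "norm x = 1"
    then show "Re (cdual_apply f x) \<le> 1"
      using bound[of x] complex_Re_le_cmod[of "g x"] app by simp
  qed simp
  have re: "Re (cdual_apply f z) = norm z"
    by (simp add: app g_def u)
  have "cmod (cdual_apply f z) \<le> norm z"
    by (simp add: app bound)
  \<comment> \<open>A number whose real part already reaches the bound on its modulus has no
    imaginary part.\<close>
  with re have "Im (cdual_apply f z) = 0"
    using cmod_power2[of "cdual_apply f z"] power_mono[of "cmod (cdual_apply f z)" "norm z" 2]
    by simp
  with re show thesis
    using that[OF f1] by (simp add: complex_eq_iff)
qed

section \<open>Differentiability of the norm\<close>

text \<open>Homogeneity reduces the definition to unit vectors, and the triangle inequality makes
  the second difference nonnegative, so an upper bound suffices.\<close>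

lemma frechet_differentiable_iff:
  "frechet_differentiable TYPE('y::banach) \<longleftrightarrow>
    (\<forall>y::'y. norm y = 1 \<longrightarrow> (\<forall>\<epsilon>>0. \<exists>\<delta>>0. \<forall>h. norm h < \<delta> \<longrightarrow>
      norm (y + h) + norm (y - h) \<le> 2 + \<epsilon> * norm h))"
  (is "?F \<longleftrightarrow> ?R")
proof
  assume F: ?F
  show ?R
  proof (intro allI impI)
    fix y :: 'y and \<epsilon> :: real
    assume y: "norm y = 1" and \<epsilon>: "\<epsilon> > 0"
    then have "((\<lambda>h. (norm (y + h) + norm (y - h) - 2 * norm y) / norm h) \<longlongrightarrow> 0) (at 0)"
      using F unfolding frechet_differentiable_def by (metis norm_zero zero_neq_one)
    then have "\<forall>\<^sub>F h in at 0. dist ((norm (y + h) + norm (y - h) - 2 * norm y) / norm h) 0 < \<epsilon>"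
      using \<epsilon> by (rule tendstoD)
    then obtain \<delta> where \<delta>: "\<delta> > 0" "\<And>h. h \<noteq> 0 \<Longrightarrow> norm h < \<delta> \<Longrightarrow>
        \<bar>(norm (y + h) + norm (y - h) - 2) / norm h\<bar> < \<epsilon>"
      unfolding eventually_at by (auto simp: y dist_norm)
    have "norm (y + h) + norm (y - h) \<le> 2 + \<epsilon> * norm h" if "norm h < \<delta>" for h
    proof (cases "h = 0")
      case False
      then have "(norm (y + h) + norm (y - h) - 2) / norm h < \<epsilon>"
        using \<delta>(2)[OF False that] by linarith
      then show ?thesis
        using False by (simp add: divide_less_eq)
    qed (simp add: y)
    then show "\<exists>\<delta>>0. \<forall>h. norm h < \<delta> \<longrightarrow> norm (y + h) + norm (y - h) \<le> 2 + \<epsilon> * norm h"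
      using \<delta>(1) by blast
  qed
next
  assume R: ?R
  show ?F
    unfolding frechet_differentiable_def
  proof (intro allI impI tendstoI)
    fix y :: 'y and \<epsilon> :: real
    assume y: "y \<noteq> 0" and \<epsilon>: "\<epsilon> > 0"
    define r where "r = norm y"
    have r: "r > 0"
      using y by (simp add: r_def)
    \<comment> \<open>Halving \<epsilon> recovers the strict inequality of the limit from the weak
      one.\<close>
    have "norm (y /\<^sub>R r) = 1" "\<epsilon> / 2 > 0"
      using y \<epsilon> by (simp_all add: r_def)
    then obtain \<delta> where \<delta>: "\<delta> > 0" "\<And>h. norm h < \<delta> \<Longrightarrow>
        norm (y /\<^sub>R r + h) + norm (y /\<^sub>R r - h) \<le> 2 + \<epsilon> / 2 * norm h"
      using R by blast
    have "dist ((norm (y + h) + norm (y - h) - 2 * norm y) / norm h) 0 < \<epsilon>"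
      if h: "h \<noteq> 0" "norm h < r * \<delta>" for h
    proof -
      have eq: "norm (y /\<^sub>R r + h /\<^sub>R r) = norm (y + h) / r"
        "norm (y /\<^sub>R r - h /\<^sub>R r) = norm (y - h) / r"
        using r by (simp_all add: divide_inverse_commute flip: scaleR_add_right scaleR_diff_right)
      have "norm (h /\<^sub>R r) < \<delta>"
        using h r by (simp add: field_simps)
      have hr: "norm (h /\<^sub>R r) = norm h / r"
        using r by (simp add: divide_inverse_commute)
      from \<delta>(2)[OF \<open>norm (h /\<^sub>R r) < \<delta>\<close>] have "(norm (y + h) + norm (y - h)) / r \<le> (2 * r + \<epsilon> / 2 * norm h) / r"
        unfolding eq hr using r by (simp add: add_divide_distrib)
      then have "norm (y + h) + norm (y - h) - 2 * r \<le> \<epsilon> / 2 * norm h"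
        using r by (simp add: divide_le_cancel)
      moreover have "2 * r \<le> norm (y + h) + norm (y - h)"
        using norm_triangle_ineq[of "y + h" "y - h"] by (simp add: r_def flip: scaleR_2)
      moreover have "\<epsilon> / 2 * norm h < \<epsilon> * norm h"
        using h \<epsilon> by simp
      ultimately show ?thesis
        using h by (simp add: r_def divide_less_eq)
    qed
    then show "\<forall>\<^sub>F h in at 0. dist ((norm (y + h) + norm (y - h) - 2 * norm y) / norm h) 0 < \<epsilon>"
      unfolding eventually_at using r \<delta>(1)
      by (intro exI[of _ "r * \<delta>"]) (auto simp: dist_norm)
  qed
qed

lemma frechet_differentiableD:
  fixes y :: "'y::banach"
  assumes "frechet_differentiable TYPE('y)" "norm y = 1" "\<epsilon> > 0"
  obtains \<delta> where "\<delta> > 0"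
    "\<And>h. norm h < \<delta> \<Longrightarrow> norm (y + h) + norm (y - h) \<le> 2 + \<epsilon> * norm h"
  using assms unfolding frechet_differentiable_iff by blast

text \<open>The point required is a functional \<open>f\<close> norming \<open>y\<close>. If
  \<open>g\<close> almost norms \<open>y\<close>, evaluating \<open>f\<close> at
  \<open>y + h\<close> and \<open>g\<close> at \<open>y - h\<close> bounds \<open>f - g\<close> on
  all \<open>h\<close> of a fixed small norm.\<close>

lemma uniformly_smooth_if_frechet_differentiable:
  assumes F: "frechet_differentiable TYPE('y::complex_banach)"
  shows "uniformly_smooth TYPE('y)"
  unfolding uniformly_smooth_def
proof
  fix y :: 'y
  assume "y \<in> sphere 0 1"
  then have y: "norm y = 1"
    by simp
  obtain f :: "'y cdual" where f: "norm f \<le> 1" "cdual_apply f y = 1"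
    using ex_norming_cdual[of y] y by auto
  have f1: "norm f = 1"
    using f Re_cdual_apply_le_unit[of y f] y by simp
  let ?P = "\<lambda>y'. y' \<in> sphere (0::'y cdual) 1 \<and>
      (\<forall>\<epsilon>>0. \<exists>\<delta>>0. \<forall>g\<in>cball (0::'y cdual) 1.
        cdual_apply g y \<in> \<real> \<and> Re (cdual_apply g y) > 1 - \<delta> \<longrightarrow> norm (y' - g) < \<epsilon>)"
  show "\<exists>!y'. ?P y'"
  proof (rule ex1I[of _ f])
    have "\<exists>\<delta>>0. \<forall>g\<in>cball 0 1. cdual_apply g y \<in> \<real> \<and> Re (cdual_apply g y) > 1 - \<delta> \<longrightarrow>
        norm (f - g) < \<epsilon>" if \<epsilon>: "\<epsilon> > 0" for \<epsilon>
    proof -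
      obtain \<eta> where \<eta>: "\<eta> > 0" "\<And>h. norm h < \<eta> \<Longrightarrow>
          norm (y + h) + norm (y - h) \<le> 2 + \<epsilon> / 4 * norm h"
        using frechet_differentiableD[OF F y, of "\<epsilon> / 4"] \<epsilon> by auto
      have "norm (f - g) < \<epsilon>"
        \<comment> \<open>With \<open>norm h = \<eta> / 2\<close>, differentiability and the defect
          of \<open>g\<close> at \<open>y\<close> each contribute
          \<open>\<epsilon> * \<eta> / 8\<close>; together this is
          \<open>\<eta> / 2 * (\<epsilon> / 2)\<close>.\<close>
        if g: "norm g \<le> 1" and gy: "Re (cdual_apply g y) > 1 - \<epsilon> / 8 * \<eta>" for g
      proof -
        have "norm (f - g) \<le> \<epsilon> / 2"
        proof (rule norm_cdual_bound_Re)
          fix x :: 'y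
          assume x: "norm x = 1"
          define h where "h = (\<eta> / 2) *\<^sub>R x"
          have nh: "norm h = \<eta> / 2"
            using \<eta>(1) x by (simp add: h_def)
          have "norm (y + h) + norm (y - h) \<le> 2 + \<epsilon> / 4 * (\<eta> / 2)"
            using \<eta>(2)[of h] \<eta>(1) nh by simp
          then have "Re (cdual_apply f (y + h)) + Re (cdual_apply g (y - h)) \<le> 2 + \<epsilon> / 4 * (\<eta> / 2)"
            using Re_cdual_apply_le_norm[OF f(1), of "y + h"] Re_cdual_apply_le_norm[OF g, of "y - h"]
            by linarith
          then have "Re (cdual_apply (f - g) h) \<le> \<eta> / 2 * (\<epsilon> / 2)"
            using gy by (simp add: f(2) field_simps)
          then have "\<eta> / 2 * Re (cdual_apply (f - g) x) \<le> \<eta> / 2 * (\<epsilon> / 2)"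
            by (simp add: h_def right_diff_distrib)
          then show "Re (cdual_apply (f - g) x) \<le> \<epsilon> / 2"
            using \<eta>(1) by (subst (asm) mult_le_cancel_left_pos) auto
        qed (use \<epsilon> in simp)
        then show ?thesis
          using \<epsilon> by simp
      qed
      then show ?thesis
        using \<eta>(1) \<epsilon> by (intro exI[of _ "\<epsilon> / 8 * \<eta>"]) auto
    qed
    then show "?P f"
      using f1 by simp
  next
    fix y'
    assume P: "?P y'"
    \<comment> \<open>Uniqueness: \<open>f\<close> pairs with \<open>y\<close> to exactly 1, so it
      is an admissible \<open>g\<close> for every \<delta>.\<close>
    have "norm (y' - f) < \<epsilon>" if pos: "\<epsilon> > 0" for \<epsilon>
    proof -
      obtain \<delta> where "\<delta> > 0" "\<forall>g\<in>cball (0::'y cdual) 1.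
        cdual_apply g y \<in> \<real> \<and> Re (cdual_apply g y) > 1 - \<delta> \<longrightarrow> norm (y' - g) < \<epsilon>"
        using P pos by blast
      then show ?thesis
        using f by simp
    qed
    from this[of "norm (y' - f)"] show "y' = f"
      by auto
  qed
qed

text \<open>Functionals \<open>f\<close> and \<open>g\<close> norming \<open>y + h\<close> and
  \<open>y - h\<close> both lie near \<open>y'\<close>, hence near each other. The second difference
  then exceeds 2 by at most \<open>Re (cdual_apply (f - g) h)\<close>.\<close>

lemma frechet_differentiable_if_uniformly_smooth:
  assumes U: "uniformly_smooth TYPE('y::complex_banach)"
  shows "frechet_differentiable TYPE('y)"
  unfolding frechet_differentiable_iff
proof (intro allI impI)
  fix y :: 'y and \<epsilon> :: real
  assume y: "norm y = 1" and \<epsilon>: "\<epsilon> > 0"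
  have "y \<in> sphere 0 1" "\<epsilon> / 4 > 0"
    using y \<epsilon> by auto
  then obtain y' :: "'y cdual" and \<delta> where \<delta>: "\<delta> > 0" and
    close: "\<And>g. norm g \<le> 1 \<Longrightarrow> cdual_apply g y \<in> \<real> \<Longrightarrow> Re (cdual_apply g y) > 1 - \<delta> \<Longrightarrow>
      norm (y' - g) < \<epsilon> / 4"
    using U unfolding uniformly_smooth_def by (metis mem_cball_0)
  \<comment> \<open>The bound \<open>\<delta> / 2\<close> keeps \<open>1 - 2 * norm h\<close>, a
    lower bound for the rotated pairing with \<open>y\<close>, above \<open>1 - \<delta>\<close>;
    the bound \<open>\<epsilon> / 16\<close> keeps the rotation cost \<open>4 * norm h\<close> below
    \<open>\<epsilon> / 4\<close>.\<close>
  define \<eta> where "\<eta> = min (\<delta> / 2) (\<epsilon> / 16)"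
  have \<eta>: "\<eta> > 0" "\<eta> \<le> \<delta> / 2" "\<eta> \<le> \<epsilon> / 16"
    using \<delta> \<epsilon> by (auto simp: \<eta>_def)
  \<comment> \<open>A functional norming \<open>y + h\<close> need not be real at \<open>y\<close>; rotating it by the unimodular \<open>c\<close>
    makes it so, at a cost proportional to \<open>norm h\<close>.\<close>
  have near: "\<exists>f. norm f \<le> 1 \<and> cdual_apply f (y + h) = norm (y + h) \<and> norm (y' - f) < \<epsilon> / 2"
    if h: "norm h < \<eta>" for h
  proof -
    obtain f :: "'y cdual" where f: "norm f \<le> 1" "cdual_apply f (y + h) = norm (y + h)"
      using ex_norming_cdual[of "y + h"] by blast
    let ?w = "cdual_apply f y"
    have fy: "?w = of_real (norm (y + h)) - cdual_apply f h"
      using f(2) by (simp add: algebra_simps)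
    have fh: "cmod (cdual_apply f h) \<le> norm h"
      using norm_cdual_apply_le[of f h] f(1) mult_right_mono[of "norm f" 1 "norm h"] by simp
    have "\<bar>norm (y + h) - 1\<bar> \<le> norm h"
      using norm_triangle_ineq3[of "y + h" y] y by simp
    then have "cmod (of_real (norm (y + h)) - 1) \<le> norm h"
      by (metis norm_of_real of_real_1 of_real_diff)
    moreover have "?w - 1 = (of_real (norm (y + h)) - 1) - cdual_apply f h"
      using fy by simp
    then have "cmod (?w - 1) \<le> cmod (of_real (norm (y + h)) - 1) + cmod (cdual_apply f h)"
      by (metis norm_triangle_ineq4)
    ultimately have w: "cmod (?w - 1) \<le> 2 * norm h"
      using fh by linarith
    have cw: "\<bar>cmod ?w - 1\<bar> \<le> 2 * norm h"
      using norm_triangle_ineq3[of ?w 1] w by simp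
    obtain c where c: "cmod c = 1" "c * ?w = of_real (cmod ?w)"
      by (rule ex_rotation)
    \<comment> \<open>Since \<open>c * ?w\<close> is the modulus of \<open>?w\<close>, the distance
      of \<open>c\<close> from 1 is controlled by those of \<open>?w\<close> and its modulus, each
      at most \<open>2 * norm h\<close>.\<close>
    have "c - 1 = (of_real (cmod ?w) - 1) - c * (?w - 1)"
      by (simp add: algebra_simps c(2))
    then have "cmod (c - 1) \<le> cmod (of_real (cmod ?w) - 1) + cmod (c * (?w - 1))"
      by (metis norm_triangle_ineq4)
    also have "\<dots> \<le> 4 * norm h"
    proof -
      have "cmod (of_real (cmod ?w) - 1) = \<bar>cmod ?w - 1\<bar>"
        by (metis norm_of_real of_real_1 of_real_diff)
      then show ?thesis
        using w cw c(1) by (simp add: norm_mult)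
    qed
    finally have c1: "cmod (c - 1) \<le> 4 * norm h" .
    have "norm (c *\<^sub>C f - f) = cmod (c - 1) * norm f"
    proof -
      have "c *\<^sub>C f = (c - 1) *\<^sub>C f + f"
        using scaleC_add_left[of "c - 1" 1 f] by (simp add: scaleC_one)
      then show ?thesis
        by (simp add: norm_scaleC)
    qed
    also have "\<dots> \<le> 4 * norm h"
      using c1 f(1) mult_mono[of "cmod (c - 1)" "4 * norm h" "norm f" 1] by simp
    finally have cf: "norm (c *\<^sub>C f - f) < \<epsilon> / 4"
      using h \<eta> by linarith
    have "norm (y' - c *\<^sub>C f) < \<epsilon> / 4"
      using f(1) c cw h \<eta> by (intro close) (auto simp: norm_scaleC)
    then have "norm (y' - f) < \<epsilon> / 2"
      using norm_triangle_ineq[of "y' - c *\<^sub>C f" "c *\<^sub>C f - f"] cf by simp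
    then show ?thesis
      using f by blast
  qed
  have "norm (y + h) + norm (y - h) \<le> 2 + \<epsilon> * norm h" if h: "norm h < \<eta>" for h
  proof -
    obtain f where f: "norm f \<le> 1" "cdual_apply f (y + h) = norm (y + h)" "norm (y' - f) < \<epsilon> / 2"
      using near[OF h] by blast
    obtain g where g: "norm g \<le> 1" "cdual_apply g (y - h) = norm (y - h)" "norm (y' - g) < \<epsilon> / 2"
      using near[of "- h"] h by auto
    have "norm (f - g) \<le> \<epsilon>"
      using norm_triangle_ineq4[of "y' - g" "y' - f"] f(3) g(3) by simp
    then have "Re (cdual_apply (f - g) h) \<le> \<epsilon> * norm h"
      using Re_cdual_apply_le[of "f - g" h] mult_right_mono[of "norm (f - g)" \<epsilon> "norm h"] by simp
    then have "Re (cdual_apply f (y + h)) + Re (cdual_apply g (y - h)) \<le> 2 + \<epsilon> * norm h"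
      using Re_cdual_apply_le_norm[OF f(1), of y] Re_cdual_apply_le_norm[OF g(1), of y] y by simp
    then show ?thesis
      by (simp only: f(2) g(2) Re_complex_of_real)
  qed
  then show "\<exists>\<delta>>0. \<forall>h. norm h < \<delta> \<longrightarrow> norm (y + h) + norm (y - h) \<le> 2 + \<epsilon> * norm h"
    using \<eta>(1) by blast
qed

section \<open>Norming sequences in the predual\<close>

text \<open>The perturbation \<open>h\<close> is a multiple of a functional norming
  \<open>x n - y n\<close>. It varies with \<open>n\<close>, but the bound depends only on its norm,
  so one radius \<open>d\<close> serves all \<open>n\<close>.\<close>

lemma norming_sequences_close_if_frechet_differentiable:
  fixes x y :: "nat \<Rightarrow> 'a::complex_normed_vector" and a :: "'a cdual"
  assumes F: "frechet_differentiable TYPE('a cdual)"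
    and x: "\<And>n. norm (x n) = 1" and y: "\<And>n. norm (y n) = 1" and a: "norm a = 1"
    and ax: "(\<lambda>n. cdual_apply a (x n)) \<longlonglongrightarrow> 1" and ay: "(\<lambda>n. cdual_apply a (y n)) \<longlonglongrightarrow> 1"
  shows "(\<lambda>n. norm (x n - y n)) \<longlonglongrightarrow> 0"
proof (rule tendstoI)
  fix \<epsilon> :: real
  assume \<epsilon>: "\<epsilon> > 0"
  obtain \<delta> where \<delta>: "\<delta> > 0" "\<And>h. norm h < \<delta> \<Longrightarrow>
      norm (a + h) + norm (a - h) \<le> 2 + \<epsilon> / 2 * norm h"
    using frechet_differentiableD[OF F a, of "\<epsilon> / 2"] \<epsilon> by auto
  define d where "d = \<delta> / 2"
  have d: "d > 0" "d < \<delta>"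
    using \<delta>(1) by (auto simp: d_def)
  have bound: "d * norm (x n - y n) \<le>
      2 + \<epsilon> / 2 * d - Re (cdual_apply a (x n)) - Re (cdual_apply a (y n))" for n
  proof -
    obtain f :: "'a cdual" where f: "norm f \<le> 1" "cdual_apply f (x n - y n) = norm (x n - y n)"
      using ex_norming_cdual[of "x n - y n"] by blast
    define h where "h = complex_of_real d *\<^sub>C f"
    have nh: "norm h \<le> d"
      using f(1) d(1) mult_left_mono[of "norm f" 1 d] by (simp add: h_def norm_scaleC)
    have hxy: "Re (cdual_apply h (x n)) - Re (cdual_apply h (y n)) = d * norm (x n - y n)"
      using arg_cong[OF f(2), of Re] by (simp add: h_def flip: right_diff_distrib)
    have "norm (a + h) + norm (a - h) \<le> 2 + \<epsilon> / 2 * norm h"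
      using \<delta>(2)[of h] nh d by simp
    also have "\<dots> \<le> 2 + \<epsilon> / 2 * d"
      using nh \<epsilon> by (simp add: mult_left_mono)
    finally show ?thesis
      using Re_cdual_apply_le_unit[of "x n" "a + h"] Re_cdual_apply_le_unit[of "y n" "a - h"] x y hxy
      by simp
  qed
  have "(\<lambda>n. Re (cdual_apply a (x n)) + Re (cdual_apply a (y n))) \<longlonglongrightarrow> Re 1 + Re 1"
    by (intro tendsto_intros ax ay)
  then have "\<forall>\<^sub>F n in sequentially.
      2 - \<epsilon> / 2 * d < Re (cdual_apply a (x n)) + Re (cdual_apply a (y n))"
    using \<epsilon> d by (intro order_tendstoD(1)) auto
  then show "\<forall>\<^sub>F n in sequentially. dist (norm (x n - y n)) 0 < \<epsilon>"
  proof eventually_elim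
    case (elim n)
    then have "d * norm (x n - y n) < d * \<epsilon>"
      using bound[of n] by (simp add: algebra_simps)
    then show ?case
      using d(1) by simp
  qed
qed

text \<open>The sequential hypothesis is first made uniform: near-norming unit vectors of
  \<open>a\<close> are close to each other. Vectors almost norming \<open>a + h\<close> and
  \<open>a - h\<close> are of this kind.\<close>

lemma frechet_differentiable_if_norming_sequences_close:
  assumes S: "\<And>(x :: nat \<Rightarrow> 'a::complex_normed_vector) y (a :: 'a cdual).
      (\<And>n. norm (x n) = 1) \<Longrightarrow> (\<And>n. norm (y n) = 1) \<Longrightarrow> norm a = 1 \<Longrightarrow>
      (\<lambda>n. cdual_apply a (x n)) \<longlonglongrightarrow> 1 \<Longrightarrow> (\<lambda>n. cdual_apply a (y n)) \<longlonglongrightarrow> 1 \<Longrightarrow>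
      (\<lambda>n. norm (x n - y n)) \<longlonglongrightarrow> 0"
  shows "frechet_differentiable TYPE('a cdual)"
  unfolding frechet_differentiable_iff
proof (intro allI impI)
  fix a :: "'a cdual" and \<epsilon> :: real
  assume a: "norm a = 1" and \<epsilon>: "\<epsilon> > 0"
  \<comment> \<open>A functional of norm 1 excludes the zero space, so unit vectors exist.\<close>
  have ne: "\<exists>x::'a. x \<noteq> 0"
  proof (rule ccontr)
    assume "\<nexists>x::'a. x \<noteq> 0"
    then have "norm x \<noteq> 1" for x :: 'a
      by (metis norm_zero zero_neq_one)
    then have "norm a \<le> 0"
      by (intro norm_cdual_bound_Re) auto
    then show False
      using a by simp
  qed
  have "\<exists>\<delta>>0. \<forall>x y. norm x = 1 \<longrightarrow> norm y = 1 \<longrightarrow> cmod (cdual_apply a x - 1) < \<delta> \<longrightarrow>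
      cmod (cdual_apply a y - 1) < \<delta> \<longrightarrow> norm (x - y) < \<epsilon> / 3"
  proof (rule ccontr)
    assume "\<not> ?thesis"
    then have "\<forall>n. \<exists>x y. norm x = 1 \<and> norm y = 1 \<and> cmod (cdual_apply a x - 1) < inverse (real (Suc n)) \<and>
      cmod (cdual_apply a y - 1) < inverse (real (Suc n)) \<and> \<not> norm (x - y) < \<epsilon> / 3"
      by (metis inverse_positive_iff_positive of_nat_0_less_iff zero_less_Suc)
    then obtain x y where xy: "\<And>n. norm (x n) = 1" "\<And>n. norm (y n) = 1"
      "\<And>n. cmod (cdual_apply a (x n) - 1) < inverse (real (Suc n))"
      "\<And>n. cmod (cdual_apply a (y n) - 1) < inverse (real (Suc n))"
      "\<And>n. \<not> norm (x n - y n) < \<epsilon> / 3"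
      by metis
    have lim: "w \<longlonglongrightarrow> 1" if "\<And>n. cmod (w n - 1) < inverse (real (Suc n))" for w
      by (rule LIM_zero_cancel, rule Lim_null_comparison[OF _ LIMSEQ_inverse_real_of_nat])
        (intro always_eventually allI less_imp_le that)
    have "(\<lambda>n. norm (x n - y n)) \<longlonglongrightarrow> 0"
      using xy a by (intro S[of x y a] lim) auto
    then have "\<forall>\<^sub>F n in sequentially. norm (x n - y n) < \<epsilon> / 3"
      using \<epsilon> by (intro order_tendstoD(2)) auto
    then show False
      using xy(5) by (simp add: eventually_sequentially) blast
  qed
  then obtain \<delta> where \<delta>: "\<delta> > 0" and
    close: "\<And>x y. norm x = 1 \<Longrightarrow> norm y = 1 \<Longrightarrow> cmod (cdual_apply a x - 1) < \<delta> \<Longrightarrow>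
      cmod (cdual_apply a y - 1) < \<delta> \<Longrightarrow> norm (x - y) < \<epsilon> / 3"
    by blast
  \<comment> \<open>Chosen to match the estimate \<open>cmod (cdual_apply a x - 1) \<le> (2 +
    \<epsilon> / 3) * norm h\<close> below.\<close>
  define \<eta> where "\<eta> = \<delta> / (2 + \<epsilon> / 3)"
  have \<eta>: "\<eta> > 0"
    using \<delta> \<epsilon> by (simp add: \<eta>_def)
  have near: "\<exists>x. norm x = 1 \<and> Re (cdual_apply (a + h) x) \<ge> norm (a + h) - \<epsilon> / 3 * norm h \<and>
      cmod (cdual_apply a x - 1) < \<delta>" if h: "h \<noteq> 0" "norm h < \<eta>" for h
  proof -
    \<comment> \<open>The slack is proportional to \<open>norm h\<close>, hence the exclusion of
      \<open>h = 0\<close>. The value at \<open>x\<close> is taken real so that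
      \<open>cdual_apply a x\<close> approaches 1 as a complex number, not just in real
      part.\<close>
    have "\<epsilon> / 3 * norm h > 0"
      using h \<epsilon> by simp
    then obtain x where x: "norm x = 1" "cdual_apply (a + h) x \<in> \<real>"
      "Re (cdual_apply (a + h) x) \<ge> norm (a + h) - \<epsilon> / 3 * norm h"
      using ex_almost_norming_vector[OF ne] by blast
    define r where "r = Re (cdual_apply (a + h) x)"
    have r: "cdual_apply (a + h) x = of_real r"
      using x(2) unfolding r_def by (rule of_real_Re[symmetric])
    have "r \<le> norm (a + h)"
      unfolding r_def using x(1) by (intro Re_cdual_apply_le_unit) simp
    then have "\<bar>r - 1\<bar> \<le> norm h + \<epsilon> / 3 * norm h"
      using x(3) norm_triangle_ineq3[of "a + h" a] a \<open>\<epsilon> / 3 * norm h > 0\<close>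
      unfolding r_def[symmetric] by simp
    then have "cmod (of_real r - 1) \<le> norm h + \<epsilon> / 3 * norm h"
      by (metis norm_of_real of_real_1 of_real_diff)
    moreover have "cdual_apply a x - 1 = (of_real r - 1) - cdual_apply h x"
      using r by (simp add: algebra_simps)
    then have "cmod (cdual_apply a x - 1) \<le> cmod (of_real r - 1) + cmod (cdual_apply h x)"
      by (metis norm_triangle_ineq4)
    moreover have "cmod (cdual_apply h x) \<le> norm h"
      using norm_cdual_apply_le[of h x] x(1) by simp
    ultimately have "cmod (cdual_apply a x - 1) \<le> (2 + \<epsilon> / 3) * norm h"
      by (simp add: algebra_simps)
    also have "\<dots> < \<delta>"
      using h \<epsilon> by (simp add: \<eta>_def field_simps)
    finally show ?thesis
      using x by blast
  qed
  have "norm (a + h) + norm (a - h) \<le> 2 + \<epsilon> * norm h" if h: "norm h < \<eta>" for h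
  proof (cases "h = 0")
    case False
    obtain x where x: "norm x = 1" "Re (cdual_apply (a + h) x) \<ge> norm (a + h) - \<epsilon> / 3 * norm h"
      "cmod (cdual_apply a x - 1) < \<delta>"
      using near[OF False h] by blast
    obtain y where y: "norm y = 1" "Re (cdual_apply (a - h) y) \<ge> norm (a - h) - \<epsilon> / 3 * norm h"
      "cmod (cdual_apply a y - 1) < \<delta>"
      using near[of "- h"] False h by auto
    \<comment> \<open>This term and the two norming defects each cost
      \<open>\<epsilon> / 3 * norm h\<close>.\<close>
    have "Re (cdual_apply h (x - y)) \<le> norm h * norm (x - y)"
      by (rule Re_cdual_apply_le)
    also have "\<dots> \<le> norm h * (\<epsilon> / 3)"
      using close[OF x(1) y(1) x(3) y(3)] by (intro mult_left_mono) auto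
    finally show ?thesis
      using x(2) y(2) Re_cdual_apply_le_unit[of x a] Re_cdual_apply_le_unit[of y a] x(1) y(1) a
      by (simp add: algebra_simps)
  qed (simp add: a)
  then show "\<exists>\<delta>>0. \<forall>h. norm h < \<delta> \<longrightarrow> norm (a + h) + norm (a - h) \<le> 2 + \<epsilon> * norm h"
    using \<eta> by blast
qed

theorem mainTheorem2:
  shows "(frechet_differentiable TYPE('a::complex_banach cdual) \<longleftrightarrow>
      (\<forall>(x :: nat \<Rightarrow> 'a) (y :: nat \<Rightarrow> 'a) (a :: 'a cdual).
        (\<forall>n. x n \<in> sphere 0 1) \<and> (\<forall>n. y n \<in> sphere 0 1) \<and> a \<in> sphere 0 1 \<and>
        (\<lambda>n. cdual_apply a (x n)) \<longlonglongrightarrow> 1 \<and> (\<lambda>n. cdual_apply a (y n)) \<longlonglongrightarrow> 1 \<longrightarrow>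
        (\<lambda>n. norm (x n - y n)) \<longlonglongrightarrow> 0))
    \<and> (frechet_differentiable TYPE('a cdual) \<longleftrightarrow> uniformly_smooth TYPE('a cdual))"
proof (intro conjI iffI allI impI)
  fix x y :: "nat \<Rightarrow> 'a" and a :: "'a cdual"
  assume "frechet_differentiable TYPE('a cdual)"
    and "(\<forall>n. x n \<in> sphere 0 1) \<and> (\<forall>n. y n \<in> sphere 0 1) \<and> a \<in> sphere 0 1 \<and>
      (\<lambda>n. cdual_apply a (x n)) \<longlonglongrightarrow> 1 \<and> (\<lambda>n. cdual_apply a (y n)) \<longlonglongrightarrow> 1"
  then show "(\<lambda>n. norm (x n - y n)) \<longlonglongrightarrow> 0"
    by (intro norming_sequences_close_if_frechet_differentiable[where a = a]) auto
next
  assume close: "\<forall>(x :: nat \<Rightarrow> 'a) (y :: nat \<Rightarrow> 'a) (a :: 'a cdual).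
        (\<forall>n. x n \<in> sphere 0 1) \<and> (\<forall>n. y n \<in> sphere 0 1) \<and> a \<in> sphere 0 1 \<and>
        (\<lambda>n. cdual_apply a (x n)) \<longlonglongrightarrow> 1 \<and> (\<lambda>n. cdual_apply a (y n)) \<longlonglongrightarrow> 1 \<longrightarrow>
        (\<lambda>n. norm (x n - y n)) \<longlonglongrightarrow> 0"
  show "frechet_differentiable TYPE('a cdual)"
    by (rule frechet_differentiable_if_norming_sequences_close, rule close[rule_format]) simp
qed (fact uniformly_smooth_if_frechet_differentiable frechet_differentiable_if_uniformly_smooth)+

end
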